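(* Let $\mathcal H$ be a complex Hilbert space, $A$ a positive bounded operator on $\mathcal H$, and let $T_1,T_2\in\mathbb B_A(\mathcal H)$. For $T\in\mathbb B_A(\mathcal H)$ put $P_T=\frac{T^{*_A}+(T^{*_A})^{*_A}}{2}$, $Q_T=\frac{T^{*_A}-(T^{*_A})^{*_A}}{2i}$ and $$\alpha(T)=\Big[\omega_A^2(T)-\tfrac14\Big(c_A^2(P_T-Q_T)+c_A^2(P_T+Q_T)+\big|\|P_T+Q_T\|_A^2-\|P_T-Q_T\|_A^2+c_A^2(P_T-Q_T)-c_A^2(P_T+Q_T)\big|\Big)\Big]^{1/2},$$ and let $h_A(T_1,T_2)=\|T_2\|_A\,\alpha(T_1)$, $h_A(T_2,T_1)=\|T_1\|_A\,\alpha(T_2)$. Then, for either choice of sign, $$\omega_A(T_1T_2\pm T_2T_1)\le2\sqrt2\,\min\{h_A(T_1,T_2),\,h_A(T_2,T_1)\}.$$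
   Context: For a positive bounded operator $A$ on $\mathcal H$: $\langle z,y\rangle_A=\langle Az,y\rangle$, $\|z\|_A=\langle z,z\rangle_A^{1/2}$, $\|S\|_A=\sup\{\|Sz\|_A:\|z\|_A=1\}$, $\omega_A(S)=\sup\{|\langle Sz,z\rangle_A|:\|z\|_A=1\}$ and $c_A(S)=\inf\{|\langle Sz,z\rangle_A|:\|z\|_A=1\}$. $\mathbb B_A(\mathcal H)$ is the set of bounded operators $S$ on $\mathcal H$ admitting an $A$-adjoint, i.e. a bounded $R$ with $AR=S^*A$; then $S^{*_A}=A^\dagger S^*A$ ($A^\dagger$ the Moore–Penrose inverse) is the distinguished one (the unique one with range in $\overline{\mathcal R(A)}$). *)

theory Defs
  imports "HOL-Analysis.Analysis"
begin

section \<open>Complex Hilbert spaces\<close>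

text \<open>
  The norm, metric and topology are those of \<^class>\<open>real_inner\<close>; the last assumption ties them to
  the complex inner product, so that \<open>norm x = sqrt (Re (cinner x x))\<close>. Positive definiteness of
  \<open>cinner\<close> is inherited from \<open>inner\<close>. The inner product is linear in its first argument.
\<close>

class complex_inner = real_inner +
  fixes scaleC :: "complex \<Rightarrow> 'a \<Rightarrow> 'a" (infixr "*\<^sub>C" 75)
    and cinner :: "'a \<Rightarrow> 'a \<Rightarrow> complex"
  assumes scaleC_add_right: "c *\<^sub>C (x + y) = c *\<^sub>C x + c *\<^sub>C y"
    and scaleC_add_left: "(c + d) *\<^sub>C x = c *\<^sub>C x + d *\<^sub>C x"
    and scaleC_scaleC: "c *\<^sub>C (d *\<^sub>C x) = (c * d) *\<^sub>C x"
    and scaleC_of_real: "complex_of_real r *\<^sub>C x = r *\<^sub>R x"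
    and cinner_commute: "cinner x y = cnj (cinner y x)"
    and cinner_add_left: "cinner (x + y) z = cinner x z + cinner y z"
    and cinner_scaleC_left: "cinner (c *\<^sub>C x) y = c * cinner x y"
    and inner_eq_Re_cinner: "inner x y = Re (cinner x y)"

class complex_hilbert_space = complex_inner + complete_space

lemma cinner_add_right: "cinner x (y + z) = cinner x y + cinner (x::'a::complex_inner) z"
  by (metis cinner_add_left cinner_commute complex_cnj_add)

lemma cinner_diff_left: "cinner (x - y) z = cinner x z - cinner (y::'a::complex_inner) z"
  using cinner_add_left[of "x - y" y z] by simp

lemma cinner_diff_right: "cinner x (y - z) = cinner x y - cinner (x::'a::complex_inner) z"
  using cinner_add_right[of x "y - z" z] by simp

lemma cinner_self_eq_0: "cinner x x = 0 \<Longrightarrow> (x::'a::complex_inner) = 0"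
  by (metis inner_eq_Re_cinner inner_eq_zero_iff zero_complex.simps(1))

instantiation complex :: complex_hilbert_space
begin

definition scaleC_complex :: "complex \<Rightarrow> complex \<Rightarrow> complex"
  where "scaleC_complex c x = c * x"

definition cinner_complex :: "complex \<Rightarrow> complex \<Rightarrow> complex"
  where "cinner_complex x y = x * cnj y"

instance
  by standard
    (simp_all add: scaleC_complex_def cinner_complex_def inner_complex_def scaleR_conv_of_real
      algebra_simps)

end


section \<open>Operators\<close>

definition bounded_clinear :: "('a::complex_inner \<Rightarrow> 'a) \<Rightarrow> bool"
  where "bounded_clinear S \<longleftrightarrow> bounded_linear S \<and> (\<forall>c x. S (c *\<^sub>C x) = c *\<^sub>C S x)"

definition positive_op :: "('a::complex_inner \<Rightarrow> 'a) \<Rightarrow> bool"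
  where "positive_op A \<longleftrightarrow> bounded_clinear A \<and> (\<forall>x. cinner (A x) x \<in> \<real>\<^sub>\<ge>\<^sub>0)"

definition cadjoint :: "('a::complex_hilbert_space \<Rightarrow> 'a) \<Rightarrow> 'a \<Rightarrow> 'a"
  where "cadjoint S = (THE R. \<forall>x y. cinner (S x) y = cinner x (R y))"

lemma cadjoint_eqI:
  assumes "\<And>x y. cinner (S x) y = cinner x (R y)"
  shows "cadjoint S = R"
  unfolding cadjoint_def
proof (rule the_equality)
  fix R' assume R': "\<forall>x y. cinner (S x) y = cinner x (R' y)"
  show "R' = R"
  proof
    fix y
    have "cinner (R' y - R y) (R' y - R y) = 0"
      using assms R' by (simp add: cinner_diff_right)
    then show "R' y = R y"
      using cinner_self_eq_0 by fastforce
  qed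
qed (use assms in simp)

definition ortho_compl :: "'a::complex_inner set \<Rightarrow> 'a set"
  where "ortho_compl V = {x. \<forall>y\<in>V. cinner x y = 0}"

text \<open>
  The Moore--Penrose inverse has domain \<open>range A + ortho_compl (range A)\<close>. It is the linear extension
  of the inverse of \<open>A\<close> restricted to the orthogonal complement of its kernel that vanishes on
  \<open>ortho_compl (range A)\<close>: it sends \<open>A x + w\<close> to \<open>x\<close>, for \<open>x\<close> orthogonal to the kernel and
  \<open>w\<close> orthogonal to the range. Outside the domain the value is unspecified.
\<close>

definition mp_inverse :: "('a::complex_hilbert_space \<Rightarrow> 'a) \<Rightarrow> 'a \<Rightarrow> 'a"
  where "mp_inverse A y =
    (THE x. x \<in> ortho_compl {z. A z = 0} \<and> y - A x \<in> ortho_compl (range A))"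

lemma mp_inverse_eqI:
  assumes A: "bounded_clinear A"
    and x: "x \<in> ortho_compl {z. A z = 0}" "y - A x \<in> ortho_compl (range A)"
  shows "mp_inverse A y = x"
  unfolding mp_inverse_def
proof (rule the_equality)
  fix x' assume x': "x' \<in> ortho_compl {z. A z = 0} \<and> y - A x' \<in> ortho_compl (range A)"
  have lin: "A (x' - x) = A x' - A x"
    using A by (simp add: bounded_clinear_def linear_simps)
  have "cinner (A (x' - x)) (A (x' - x))
      = cinner (y - A x) (A (x' - x)) - cinner (y - A x') (A (x' - x))"
    unfolding cinner_diff_left[symmetric] by (simp add: lin)
  also have "\<dots> = 0"
    using x x' by (simp add: ortho_compl_def)
  finally have "A (x' - x) = 0"
    by (rule cinner_self_eq_0)
  then have "cinner x' (x' - x) = 0" "cinner x (x' - x) = 0"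
    using x x' by (simp_all add: ortho_compl_def)
  then have "cinner (x' - x) (x' - x) = 0"
    by (simp add: cinner_diff_left)
  then show "x' = x"
    using cinner_self_eq_0 by fastforce
qed (use x in simp)


section \<open>The semi-inner product induced by a positive operator\<close>

definition A_inner :: "('a::complex_inner \<Rightarrow> 'a) \<Rightarrow> 'a \<Rightarrow> 'a \<Rightarrow> complex"
  where "A_inner A z y = cinner (A z) y"

definition A_norm :: "('a::complex_inner \<Rightarrow> 'a) \<Rightarrow> 'a \<Rightarrow> real"
  where "A_norm A z = sqrt (Re (A_inner A z z))"

definition A_sphere :: "('a::complex_inner \<Rightarrow> 'a) \<Rightarrow> 'a set"
  where "A_sphere A = {z. A_norm A z = 1}"

text \<open>
  The unit sphere is empty exactly when \<open>A = 0\<close>; in that degenerate case the three quantities below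
  are taken to be \<open>0\<close>. The suprema are real-valued, hence meaningful only for operators for
  which they are finite; this includes all operators with an \<open>A\<close>-adjoint.
\<close>

definition A_opnorm :: "('a::complex_inner \<Rightarrow> 'a) \<Rightarrow> ('a \<Rightarrow> 'a) \<Rightarrow> real"
  where "A_opnorm A S =
    (if A_sphere A = {} then 0 else SUP z\<in>A_sphere A. A_norm A (S z))"

definition A_numradius :: "('a::complex_inner \<Rightarrow> 'a) \<Rightarrow> ('a \<Rightarrow> 'a) \<Rightarrow> real"
  where "A_numradius A S =
    (if A_sphere A = {} then 0 else SUP z\<in>A_sphere A. cmod (A_inner A (S z) z))"

definition A_crawford :: "('a::complex_inner \<Rightarrow> 'a) \<Rightarrow> ('a \<Rightarrow> 'a) \<Rightarrow> real"
  where "A_crawford A S =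
    (if A_sphere A = {} then 0 else INF z\<in>A_sphere A. cmod (A_inner A (S z) z))"

definition A_adjointable :: "('a::complex_hilbert_space \<Rightarrow> 'a) \<Rightarrow> ('a \<Rightarrow> 'a) set"
  where "A_adjointable A =
    {S. bounded_clinear S \<and> (\<exists>R. bounded_clinear R \<and> A \<circ> R = cadjoint S \<circ> A)}"

definition A_adjoint :: "('a::complex_hilbert_space \<Rightarrow> 'a) \<Rightarrow> ('a \<Rightarrow> 'a) \<Rightarrow> 'a \<Rightarrow> 'a"
  where "A_adjoint A S = mp_inverse A \<circ> cadjoint S \<circ> A"


section \<open>The quantities in the bound\<close>

definition P_op :: "('a::complex_hilbert_space \<Rightarrow> 'a) \<Rightarrow> ('a \<Rightarrow> 'a) \<Rightarrow> 'a \<Rightarrow> 'a"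
  where "P_op A T = (\<lambda>z. (1 / 2) *\<^sub>C (A_adjoint A T z + A_adjoint A (A_adjoint A T) z))"

definition Q_op :: "('a::complex_hilbert_space \<Rightarrow> 'a) \<Rightarrow> ('a \<Rightarrow> 'a) \<Rightarrow> 'a \<Rightarrow> 'a"
  where "Q_op A T = (\<lambda>z. (1 / (2 * \<i>)) *\<^sub>C (A_adjoint A T z - A_adjoint A (A_adjoint A T) z))"

definition alpha :: "('a::complex_hilbert_space \<Rightarrow> 'a) \<Rightarrow> ('a \<Rightarrow> 'a) \<Rightarrow> real"
  where "alpha A T =
    (let S = (\<lambda>z. P_op A T z + Q_op A T z);
         D = (\<lambda>z. P_op A T z - Q_op A T z)
     in sqrt ((A_numradius A T)\<^sup>2 - 1 / 4 *
          ((A_crawford A D)\<^sup>2 + (A_crawford A S)\<^sup>2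
           + \<bar>(A_opnorm A S)\<^sup>2 - (A_opnorm A D)\<^sup>2 + (A_crawford A D)\<^sup>2 - (A_crawford A S)\<^sup>2\<bar>)))"

definition h_bound ::
  "('a::complex_hilbert_space \<Rightarrow> 'a) \<Rightarrow> ('a \<Rightarrow> 'a) \<Rightarrow> ('a \<Rightarrow> 'a) \<Rightarrow> real"
  where "h_bound A T1 T2 = A_opnorm A T2 * alpha A T1"

end

theory Submission
  imports Defs
begin

text \<open>
  Modulo the kernel of \<open>A\<close> the second \<open>A\<close>-adjoint of \<open>T\<close> is \<open>T\<close> itself, so \<open>P\<^sub>T\<close> and \<open>-Q\<^sub>T\<close> are the
  real and imaginary parts of \<open>T\<close>. With \<open>D = P\<^sub>T - Q\<^sub>T\<close> and \<open>S = P\<^sub>T + Q\<^sub>T\<close>, both \<open>A\<close>-selfadjoint, one has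
  \<open>|\<langle>D z, z\<rangle>|\<^sup>2 + |\<langle>S z, z\<rangle>|\<^sup>2 = 2 |\<langle>T z, z\<rangle>|\<^sup>2\<close>. Since the \<open>A\<close>-norm of an \<open>A\<close>-selfadjoint operator is
  its \<open>A\<close>-numerical radius, this bounds both \<open>\<parallel>D\<parallel>\<^sup>2 + c(S)\<^sup>2\<close> and \<open>\<parallel>S\<parallel>\<^sup>2 + c(D)\<^sup>2\<close> by \<open>2 \<omega>(T)\<^sup>2\<close>; writing the
  maximum of the two as half of sum plus absolute difference gives \<open>\<parallel>D\<parallel>\<^sup>2 + \<parallel>S\<parallel>\<^sup>2 \<le> 4 \<alpha>(T)\<^sup>2\<close>.
  As \<open>\<parallel>D x\<parallel>\<^sup>2 + \<parallel>S x\<parallel>\<^sup>2\<close> equals \<open>\<parallel>T x\<parallel>\<^sup>2\<close> plus the same quantity for the adjoint, the two terms of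
  the commutator are estimated by Cauchy--Schwarz.
\<close>

section \<open>Orthogonal projections and the Riesz representation\<close>

text \<open>A minimizing sequence for the distance from \<open>x\<close> to \<open>V\<close> is
  Cauchy by the parallelogram law. Its limit attains the distance, and varying it along a direction
  in \<open>V\<close> forces the residual to be orthogonal.\<close>

lemma orthogonal_projection_exists:
  fixes V :: "'a::{real_inner,complete_space} set"
  assumes V: "subspace V" "closed V"
  obtains p where "p \<in> V" "\<And>v. v \<in> V \<Longrightarrow> inner (x - p) v = 0"
proof -
  define d where "d = (INF v\<in>V. (norm (x - v))\<^sup>2)"
  have ne: "V \<noteq> {}"
    using V(1) subspace_0 by blast
  have bdd: "bdd_below ((\<lambda>v. (norm (x - v))\<^sup>2) ` V)"
    by (rule bdd_belowI[of _ 0]) auto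
  have d_le: "d \<le> (norm (x - v))\<^sup>2" if "v \<in> V" for v
    unfolding d_def by (rule cINF_lower[OF bdd that])
  have "\<exists>v\<in>V. (norm (x - v))\<^sup>2 < d + 1 / real (Suc n)" for n
    using cINF_less_iff[OF ne bdd, of "d + 1 / real (Suc n)"] by (simp add: d_def)
  then obtain v where vV: "\<And>n. v n \<in> V"
    and v: "\<And>n. (norm (x - v n))\<^sup>2 < d + 1 / real (Suc n)"
    by metis
  have near: "(norm (v m - v n))\<^sup>2 \<le> 2 / real (Suc m) + 2 / real (Suc n)" for m n
  proof -
    \<comment> \<open>The midpoint stays in \<open>V\<close>, so its squared distance to
      \<open>x\<close> is at least \<open>d\<close>; the parallelogram identity then leaves little
      room between \<open>v m\<close> and \<open>v n\<close>.\<close>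
    have "(1/2) *\<^sub>R (v m + v n) \<in> V"
      using V(1) vV by (simp add: subspace_add subspace_scale)
    then have "4 * d \<le> 4 * (norm (x - (1/2) *\<^sub>R (v m + v n)))\<^sup>2"
      using d_le by simp
    moreover have "(norm (v m - v n))\<^sup>2 + 4 * (norm (x - (1/2) *\<^sub>R (v m + v n)))\<^sup>2
        = 2 * (norm (x - v m))\<^sup>2 + 2 * (norm (x - v n))\<^sup>2"
      unfolding power2_norm_eq_inner
      by (simp add: inner_add_left inner_add_right inner_diff_left inner_diff_right
          inner_commute[of "v m" x] inner_commute[of "v n" x] inner_commute[of "v n" "v m"]
          add_divide_distrib diff_divide_distrib)
    ultimately show ?thesis
      using v[of m] v[of n] by simp
  qed
  have "Cauchy v"
  proof (rule CauchyI)
    fix e :: real assume e: "0 < e"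
    then obtain M where M: "4 / e\<^sup>2 < real M"
      using reals_Archimedean2 by blast
    have "norm (v m - v n) < e" if "M \<le> m" "M \<le> n" for m n
    proof -
      have Mpos: "0 < real M"
        using M e by (smt (verit) divide_nonneg_nonneg zero_le_power2)
      have shrink: "2 / real (Suc k) < 2 / real M" if "M \<le> k" for k
        using that Mpos by (intro divide_strict_left_mono) auto
      then have "(norm (v m - v n))\<^sup>2 < 2 / real M + 2 / real M"
        using near[of m n] shrink[OF that(1)] shrink[OF that(2)] by linarith
      also have "\<dots> < e\<^sup>2"
        using M Mpos e by (simp add: field_simps)
      finally show ?thesis
        using e power_less_imp_less_base by fastforce
    qed
    then show "\<exists>M. \<forall>m\<ge>M. \<forall>n\<ge>M. norm (v m - v n) < e"
      by blast
  qed
  then obtain p where p: "v \<longlonglongrightarrow> p"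
    using Cauchy_convergent convergent_def by blast
  have pV: "p \<in> V"
    using closed_sequentially[OF V(2) _ p] vV by blast
  have lim: "(\<lambda>n. d + 1 / real (Suc n)) \<longlonglongrightarrow> d + 0"
    by (intro tendsto_intros LIMSEQ_Suc[OF lim_1_over_n])
  have "(\<lambda>n. (norm (x - v n))\<^sup>2) \<longlonglongrightarrow> (norm (x - p))\<^sup>2"
    by (intro tendsto_intros p)
  then have "(norm (x - p))\<^sup>2 \<le> d + 0"
    by (rule LIMSEQ_le[OF _ lim]) (meson v less_imp_le)
  then have p_le: "(norm (x - p))\<^sup>2 \<le> d"
    by simp
  have expand: "(norm (y - t *\<^sub>R w))\<^sup>2 = (norm y)\<^sup>2 - 2 * (t * inner y w) + t * (t * inner w w)"
    for y w :: 'a and t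
    unfolding power2_norm_eq_inner
    by (simp add: inner_diff_left inner_diff_right inner_commute[of w y] algebra_simps)
  have "inner (x - p) w = 0" if w: "w \<in> V" for w
  proof (cases "w = 0")
    case False
    \<comment> \<open>This \<open>t\<close> minimizes the quadratic polynomial giving the squared
      norm of \<open>(x - p) - t *\<^sub>R w\<close>.\<close>
    define t where "t = inner (x - p) w / inner w w"
    have "p + t *\<^sub>R w \<in> V"
      using V(1) pV w by (simp add: subspace_add subspace_scale)
    then have "(norm (x - p))\<^sup>2 \<le> (norm ((x - p) - t *\<^sub>R w))\<^sup>2"
      using order_trans[OF p_le d_le] by (simp only: diff_diff_eq)
    also have "\<dots> = (norm (x - p))\<^sup>2 - 2 * t * inner (x - p) w + t\<^sup>2 * inner w w"
      unfolding expand by (simp add: power2_eq_square mult.assoc)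
    also have "\<dots> = (norm (x - p))\<^sup>2 - (inner (x - p) w)\<^sup>2 / inner w w"
      using False by (simp add: t_def power2_eq_square field_simps)
    finally have "(inner (x - p) w)\<^sup>2 / inner w w \<le> 0"
      by simp
    moreover have "0 < inner w w"
      using False by simp
    ultimately show ?thesis
      by (smt (verit) divide_pos_pos zero_less_power2)
  qed simp
  then show thesis
    using that pV by blast
qed

lemma riesz_representation:
  fixes f :: "'a::{real_inner,complete_space} \<Rightarrow> real"
  assumes f: "bounded_linear f"
  obtains r where "\<And>x. f x = inner x r"
proof (cases "\<forall>x. f x = 0")
  case True
  then show thesis
    using that[of 0] by simp
next
  case False
  then obtain x0 where x0: "f x0 \<noteq> 0"
    by blast
  have "subspace {x. f x = 0}"
    using f by (intro linear_subspace_kernel bounded_linear.linear)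
  moreover have "closed {x. f x = 0}"
    using f by (intro closed_Collect_eq continuous_intros linear_continuous_on)
  ultimately obtain p where p: "f p = 0" "\<And>v. f v = 0 \<Longrightarrow> inner (x0 - p) v = 0"
    using orthogonal_projection_exists[of "{x. f x = 0}" x0] by auto
  \<comment> \<open>A vector orthogonal to the kernel of \<open>f\<close>; as the kernel has
    codimension one, a multiple of \<open>u\<close> represents \<open>f\<close>.\<close>
  define u where "u = x0 - p"
  have fu: "f u \<noteq> 0"
    using x0 p(1) f by (simp add: u_def linear_simps)
  then have u: "inner u u \<noteq> 0"
    using f by (auto simp: linear_simps)
  have "f x = inner x ((f u / inner u u) *\<^sub>R u)" for x
  proof -
    have "f (x - (f x / f u) *\<^sub>R u) = 0"
      using f fu by (simp add: linear_simps)
    then have "inner u (x - (f x / f u) *\<^sub>R u) = 0"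
      using p(2) by (simp add: u_def)
    then have "inner x u = f x / f u * inner u u"
      by (simp add: inner_diff_right inner_commute)
    then show ?thesis
      using fu u by (simp add: field_simps)
  qed
  then show thesis
    using that by blast
qed


section \<open>Complex inner products and adjoints\<close>

lemma cinner_scaleC_right: "cinner x (c *\<^sub>C y) = cnj c * cinner x (y::'a::complex_inner)"
  by (metis cinner_commute cinner_scaleC_left complex_cnj_mult complex_cnj_cnj)

lemma Im_cinner: "Im (cinner x y) = inner ((- \<i>) *\<^sub>C x) (y::'a::complex_inner)"
  by (simp add: inner_eq_Re_cinner cinner_scaleC_left)

lemma norm_scaleC: "norm (c *\<^sub>C x) = cmod c * norm (x::'a::complex_inner)"
proof -
  have "(norm (c *\<^sub>C x))\<^sup>2 = ((Re c)\<^sup>2 + (Im c)\<^sup>2) * Re (cinner x x)"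
    unfolding power2_norm_eq_inner inner_eq_Re_cinner
    by (simp add: cinner_scaleC_left cinner_scaleC_right power2_eq_square algebra_simps)
  also have "\<dots> = (cmod c * norm x)\<^sup>2"
    by (simp only: cmod_power2 power_mult_distrib power2_norm_eq_inner inner_eq_Re_cinner)
  finally show ?thesis
    by (simp add: power2_eq_iff_nonneg)
qed

lemma bounded_clinear_simps:
  assumes "bounded_clinear S"
  shows "S (x + y) = S x + S y" "S (x - y) = S x - S y" "S (c *\<^sub>C x) = c *\<^sub>C S x"
    "S (r *\<^sub>R x) = r *\<^sub>R S x" "S 0 = 0"
  using assms by (simp_all add: bounded_clinear_def linear_simps)

lemma bounded_linear_scaleC: "bounded_linear (\<lambda>x. c *\<^sub>C (x::'a::complex_inner))"
proof (rule bounded_linear_intro[where K = "cmod c"])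
  show "c *\<^sub>C (r *\<^sub>R x) = r *\<^sub>R c *\<^sub>C x" for r and x :: 'a
    by (metis scaleC_of_real scaleC_scaleC mult.commute)
qed (simp_all add: scaleC_add_right norm_scaleC)

lemma bounded_clinear_add:
  "bounded_clinear S \<Longrightarrow> bounded_clinear R \<Longrightarrow> bounded_clinear (\<lambda>x. S x + R x)"
  by (simp add: bounded_clinear_def bounded_linear_add scaleC_add_right)

lemma bounded_clinear_scaleC:
  "bounded_clinear S \<Longrightarrow> bounded_clinear (\<lambda>x. c *\<^sub>C S x)"
  by (simp add: bounded_clinear_def bounded_linear_compose[OF bounded_linear_scaleC]
      scaleC_scaleC mult.commute)

lemma scaleC_minus1: "(- 1) *\<^sub>C x = - (x::'a::complex_inner)"
  using scaleC_of_real[of "-1" x] by simp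

lemma bounded_clinear_diff:
  assumes "bounded_clinear S" "bounded_clinear R"
  shows "bounded_clinear (\<lambda>x. S x - R x)"
  using bounded_clinear_add[OF assms(1) bounded_clinear_scaleC[OF assms(2), of "-1"]]
  by (simp add: scaleC_minus1)

lemma bounded_clinear_compose:
  "bounded_clinear S \<Longrightarrow> bounded_clinear R \<Longrightarrow> bounded_clinear (\<lambda>x. S (R x))"
  by (simp add: bounded_clinear_def bounded_linear_compose)

text \<open>Existence behind the definite description: the real Riesz theorem gives the adjoint for
  \<open>inner\<close>, and complex linearity of \<open>S\<close> carries the identity over to
  imaginary parts.\<close>

lemma cinner_cadjoint:
  fixes S :: "'a::complex_hilbert_space \<Rightarrow> 'a"
  assumes S: "bounded_clinear S"
  shows "cinner (S x) y = cinner x (cadjoint S y)"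
proof -
  have "\<exists>r. \<forall>x. inner (S x) y = inner x r" for y
  proof -
    have "bounded_linear (\<lambda>x. inner (S x) y)"
      using S bounded_linear_compose[OF bounded_linear_inner_left]
      by (auto simp: bounded_clinear_def)
    then show ?thesis
      using riesz_representation by metis
  qed
  then obtain R where R: "\<And>x y. inner (S x) y = inner x (R y)"
    by metis
  have eq: "cinner (S x) y = cinner x (R y)" for x y
    by (rule complex_eqI)
      (simp_all add: inner_eq_Re_cinner[symmetric] R Im_cinner bounded_clinear_simps(3)[OF S, symmetric])
  then have "cadjoint S = R"
    by (rule cadjoint_eqI)
  then show ?thesis
    using eq by simp
qed

text \<open>Meant for \<open>V\<close> the kernel of \<open>A\<close>, where \<open>q\<close> cuts a
  given operator down to values orthogonal to that kernel.\<close>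

lemma ortho_compl_projection:
  fixes V :: "'a::complex_hilbert_space set"
  assumes V: "subspace V" "closed V" and VC: "\<And>c v. v \<in> V \<Longrightarrow> c *\<^sub>C v \<in> V"
  obtains q where "bounded_clinear q" "\<And>x. q x \<in> ortho_compl V" "\<And>x. x - q x \<in> V"
proof -
  \<comment> \<open>Real orthogonality suffices: \<open>V\<close> is stable under multiplication by
    \<open>- \<i>\<close>, which accounts for the imaginary part.\<close>
  have orthI: "u \<in> ortho_compl V" if u: "\<And>v. v \<in> V \<Longrightarrow> inner u v = 0" for u
  proof -
    have "cinner u v = 0" if v: "v \<in> V" for v
    proof -
      have "Re (cinner v u) = 0" "Im (cinner v u) = 0"
        using u[OF v] u[OF VC[OF v, of "- \<i>"]]
        by (simp_all only: Im_cinner inner_eq_Re_cinner[symmetric] inner_commute[of _ u])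
      then have "cinner v u = 0"
        by (simp add: complex_eq_iff)
      then show ?thesis
        by (subst cinner_commute) simp
    qed
    then show ?thesis
      by (simp add: ortho_compl_def)
  qed
  have "\<exists>u. u \<in> ortho_compl V \<and> x - u \<in> V" for x
  proof -
    obtain p where "p \<in> V" "\<And>v. v \<in> V \<Longrightarrow> inner (x - p) v = 0"
      using orthogonal_projection_exists[OF V] by blast
    then show ?thesis
      using orthI by (intro exI[of _ "x - p"]) simp
  qed
  then obtain q where q: "\<And>x. q x \<in> ortho_compl V" "\<And>x. x - q x \<in> V"
    by metis
  \<comment> \<open>Uniqueness of the decomposition turns the pointwise choice \<open>q\<close> into
    a complex linear map.\<close>
  have uniq: "q x = u" if u: "u \<in> ortho_compl V" "x - u \<in> V" for x u
  proof -
    have "q x - u \<in> V"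
      using subspace_diff[OF V(1) u(2) q(2)[of x]] by simp
    then have "cinner (q x - u) (q x - u) = 0"
      using u(1) q(1)[of x] by (simp add: ortho_compl_def cinner_diff_left)
    then show ?thesis
      using cinner_self_eq_0 by fastforce
  qed
  have qC: "q (c *\<^sub>C x) = c *\<^sub>C q x" for c x
  proof (rule uniq)
    show "c *\<^sub>C q x \<in> ortho_compl V"
      using q(1)[of x] by (simp add: ortho_compl_def cinner_scaleC_left)
    show "c *\<^sub>C x - c *\<^sub>C q x \<in> V"
      using VC[OF q(2)[of x], of c] by (simp add: linear_simps[OF bounded_linear_scaleC])
  qed
  have "bounded_linear q"
  proof (rule bounded_linear_intro[where K = 1])
    show "q (x + y) = q x + q y" for x y
    proof (rule uniq)
      show "q x + q y \<in> ortho_compl V"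
        using q(1)[of x] q(1)[of y] by (simp add: ortho_compl_def cinner_add_left)
      show "x + y - (q x + q y) \<in> V"
        using subspace_add[OF V(1) q(2)[of x] q(2)[of y]] by (simp add: algebra_simps)
    qed
    show "q (r *\<^sub>R x) = r *\<^sub>R q x" for r x
      using qC by (simp add: scaleC_of_real[symmetric])
    show "norm (q x) \<le> norm x * 1" for x
    proof -
      have "inner (q x) (x - q x) = 0"
        using q(1,2)[of x] by (simp add: ortho_compl_def inner_eq_Re_cinner)
      then have "(norm x)\<^sup>2 = (norm (q x))\<^sup>2 + (norm (x - q x))\<^sup>2"
        unfolding power2_norm_eq_inner
        by (simp add: inner_diff_left inner_diff_right inner_commute)
      then show ?thesis
        by (simp add: power2_le_imp_le)
    qed
  qed
  then show thesis
    using that[of q] q qC by (simp add: bounded_clinear_def)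
qed


section \<open>The semi-inner product of a positive operator\<close>

context
  fixes A :: "'a::complex_hilbert_space \<Rightarrow> 'a"
  assumes A: "positive_op A"
begin

lemma A_clinear: "bounded_clinear A"
  using A by (simp add: positive_op_def)

lemma A_inner_add_left: "A_inner A (x + y) z = A_inner A x z + A_inner A y z"
  by (simp add: A_inner_def bounded_clinear_simps[OF A_clinear] cinner_add_left)

lemma A_inner_diff_left: "A_inner A (x - y) z = A_inner A x z - A_inner A y z"
  by (simp add: A_inner_def bounded_clinear_simps[OF A_clinear] cinner_diff_left)

lemma A_inner_scaleC_left: "A_inner A (c *\<^sub>C x) z = c * A_inner A x z"
  by (simp add: A_inner_def bounded_clinear_simps[OF A_clinear] cinner_scaleC_left)

lemma A_inner_add_right: "A_inner A x (y + z) = A_inner A x y + A_inner A x z"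
  by (simp add: A_inner_def cinner_add_right)

lemma A_inner_diff_right: "A_inner A x (y - z) = A_inner A x y - A_inner A x z"
  by (simp add: A_inner_def cinner_diff_right)

lemma A_inner_scaleC_right: "A_inner A x (c *\<^sub>C y) = cnj c * A_inner A x y"
  by (simp add: A_inner_def cinner_scaleC_right)

lemmas A_inner_simps = A_inner_add_left A_inner_diff_left A_inner_scaleC_left
  A_inner_add_right A_inner_diff_right A_inner_scaleC_right

lemma A_inner_self: "0 \<le> Re (A_inner A x x)" "Im (A_inner A x x) = 0"
  using A by (auto simp: positive_op_def A_inner_def complex_nonneg_Reals_iff)

text \<open>Hermitian symmetry by polarization: the quadratic form is real at \<open>x + y\<close>
  and at \<open>\<i> *\<^sub>C x + y\<close>.\<close>

lemma A_inner_commute: "A_inner A x y = cnj (A_inner A y x)"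
proof -
  have "Im (A_inner A x y + A_inner A y x) = 0"
    using A_inner_self(2)[of "x + y"] A_inner_self(2)[of x] A_inner_self(2)[of y]
    by (simp add: A_inner_simps)
  moreover have "Re (A_inner A x y - A_inner A y x) = 0"
    using A_inner_self(2)[of "\<i> *\<^sub>C x + y"] A_inner_self(2)[of x] A_inner_self(2)[of y]
    by (simp add: A_inner_simps)
  ultimately show ?thesis
    by (simp add: complex_eq_iff)
qed

lemma cinner_A_commute: "cinner (A x) y = cinner x (A y)"
  by (metis A_inner_commute A_inner_def cinner_commute)

lemma A_norm_nonneg: "0 \<le> A_norm A x"
  by (simp add: A_norm_def A_inner_self)

lemma A_norm_sq: "(A_norm A x)\<^sup>2 = Re (A_inner A x x)"
  by (simp add: A_norm_def A_inner_self)

lemma A_inner_self_eq: "A_inner A x x = complex_of_real ((A_norm A x)\<^sup>2)"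
  by (simp add: A_norm_sq A_inner_self(2) complex_eq_iff)

lemma A_norm_scaleC: "A_norm A (c *\<^sub>C x) = cmod c * A_norm A x"
proof -
  have "(A_norm A (c *\<^sub>C x))\<^sup>2 = ((Re c)\<^sup>2 + (Im c)\<^sup>2) * Re (A_inner A x x)"
    unfolding A_norm_sq by (simp add: A_inner_simps power2_eq_square algebra_simps)
  also have "\<dots> = (cmod c * A_norm A x)\<^sup>2"
    by (simp only: cmod_power2 power_mult_distrib A_norm_sq)
  finally show ?thesis
    by (simp add: power2_eq_iff_nonneg A_norm_nonneg)
qed

lemma A_norm_parallelogram:
  "(A_norm A (x - y))\<^sup>2 + (A_norm A (x + y))\<^sup>2 = 2 * (A_norm A x)\<^sup>2 + 2 * (A_norm A y)\<^sup>2"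
  unfolding A_norm_sq by (simp add: A_inner_simps)

text \<open>The form is nonnegative on all real combinations of \<open>x\<close> and
  \<open>y\<close>. It may be degenerate, so a \<open>y\<close> of seminorm zero is treated
  separately.\<close>

lemma A_cauchy_schwarz_Re: "Re (A_inner A x y) \<le> A_norm A x * A_norm A y"
proof -
  define a b r where "a = A_norm A x" and "b = A_norm A y" and "r = Re (A_inner A x y)"
  have pos: "0 \<le> s\<^sup>2 * a\<^sup>2 + 2 * s * t * r + t\<^sup>2 * b\<^sup>2" for s t
  proof -
    have "Re (A_inner A y x) = r"
      unfolding r_def by (subst A_inner_commute) simp
    then show ?thesis
      using A_inner_self(1)[of "complex_of_real s *\<^sub>C x + complex_of_real t *\<^sub>C y"]
      unfolding a_def b_def A_norm_sq
      by (simp add: A_inner_simps r_def power2_eq_square algebra_simps)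
  qed
  have ab: "0 \<le> a" "0 \<le> b"
    by (simp_all add: a_def b_def A_norm_nonneg)
  have "r \<le> a * b"
  proof (cases "b = 0")
    case True
    have "r \<le> 0"
    proof (rule ccontr)
      assume "\<not> r \<le> 0"
      then show False
        \<comment> \<open>With \<open>b = 0\<close> the form is affine in \<open>t\<close>, and this
          choice gives it the value \<open>-1\<close>.\<close>
        using pos[of 1 "- (a\<^sup>2 + 1) / (2 * r)"] True by (simp add: field_simps)
    qed
    then show ?thesis
      using True by simp
  next
    case False
    have "0 \<le> b\<^sup>2 * ((a * b)\<^sup>2 - r\<^sup>2)"
      using pos[of "b\<^sup>2" "- r"] by (simp add: power2_eq_square algebra_simps)
    then have "r\<^sup>2 \<le> (a * b)\<^sup>2"
      using False by (simp add: zero_le_mult_iff)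
    then show ?thesis
      using ab abs_le_square_iff[of r "a * b"] by simp
  qed
  then show ?thesis
    by (simp add: a_def b_def r_def)
qed

lemma A_cauchy_schwarz: "cmod (A_inner A x y) \<le> A_norm A x * A_norm A y"
proof (cases "A_inner A x y = 0")
  case False
  \<comment> \<open>A unimodular factor rotating the inner product onto the nonnegative real
    axis.\<close>
  define c where "c = cnj (sgn (A_inner A x y))"
  have c: "cmod c = 1"
    using False by (simp add: c_def norm_sgn)
  have "cmod (A_inner A x y) = Re (A_inner A (c *\<^sub>C x) y)"
    using False unfolding A_inner_scaleC_left c_def sgn_eq
    by (simp add: complex_norm_square[symmetric] mult.commute power2_eq_square
        flip: of_real_power of_real_divide of_real_mult)
  also have "\<dots> \<le> A_norm A x * A_norm A y"
    using A_cauchy_schwarz_Re[of "c *\<^sub>C x" y] c by (simp add: A_norm_scaleC)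
  finally show ?thesis .
qed (simp add: A_norm_nonneg)


section \<open>Adjoint pairs\<close>

text \<open>
  If \<open>W\<close> expanded some vector by a factor \<open>r > b\<close> in the \<open>A\<close>-seminorm, log-convexity of
  \<open>k \<mapsto> \<parallel>W\<^sup>k x\<parallel>\<close> would propagate that factor to all further iterates, against their growth in norm.
\<close>

lemma A_selfadjoint_bound:
  assumes W: "\<And>x y. A_inner A (W x) y = A_inner A x (W y)"
    and b: "0 < b" "\<And>x. norm (W x) \<le> b * norm x"
  shows "A_norm A (W x) \<le> b * A_norm A x"
proof (rule ccontr)
  assume less: "\<not> A_norm A (W x) \<le> b * A_norm A x"
  define a where "a k = A_norm A ((W ^^ k) x)" for k
  have a_nonneg: "0 \<le> a k" for k
    by (simp add: a_def A_norm_nonneg)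
  have convex: "(a (Suc k))\<^sup>2 \<le> a k * a (Suc (Suc k))" for k
    using A_cauchy_schwarz_Re[of "(W ^^ k) x" "(W ^^ Suc (Suc k)) x"]
    unfolding a_def A_norm_sq by (simp add: W)
  have a1: "b * a 0 < a 1"
    using less by (simp add: a_def)
  \<comment> \<open>If \<open>a 0\<close> vanished, convexity would make \<open>a 1\<close> vanish
    too, against \<open>a1\<close>.\<close>
  have "a 0 \<noteq> 0"
    using convex[of 0] a1 by auto
  then have a0: "0 < a 0"
    using a_nonneg[of 0] by simp
  define r where "r = a 1 / a 0"
  have r: "b < r"
    using a1 a0 by (simp add: r_def field_simps)
  have step: "0 < a k \<and> r * a k \<le> a (Suc k)" for k
  proof (induction k)
    case 0
    then show ?case
      using a0 by (simp add: r_def)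
  next
    case (Suc k)
    have pos: "0 < a (Suc k)"
      using Suc r b(1) by (smt (verit) mult_pos_pos)
    have "(r * a k) * a (Suc k) \<le> (a (Suc k))\<^sup>2"
      using Suc pos by (simp add: power2_eq_square)
    also have "\<dots> \<le> a k * a (Suc (Suc k))"
      by (rule convex)
    finally have "a k * (r * a (Suc k)) \<le> a k * a (Suc (Suc k))"
      by (simp add: algebra_simps)
    then show ?case
      using Suc pos by simp
  qed
  have lower: "r ^ k * a 0 \<le> a k" for k
  proof (induction k)
    case (Suc k)
    have "r ^ Suc k * a 0 \<le> r * a k"
      using Suc r b(1) by (simp add: mult.assoc)
    then show ?case
      using step[of k] by linarith
  qed simp
  obtain K where K: "0 < K" "\<And>y. norm (A y) \<le> norm y * K"
    using A_clinear bounded_linear.pos_bounded unfolding bounded_clinear_def by blast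
  \<comment> \<open>Domination of the seminorm by the norm limits the growth of \<open>a k\<close>
    to that of \<open>b ^ k\<close>.\<close>
  have Anorm: "A_norm A y \<le> sqrt K * norm y" for y
  proof -
    have "(A_norm A y)\<^sup>2 = inner (A y) y"
      by (simp add: A_norm_sq A_inner_def inner_eq_Re_cinner)
    also have "\<dots> \<le> norm (A y) * norm y"
      by (rule norm_cauchy_schwarz)
    also have "\<dots> \<le> K * (norm y)\<^sup>2"
      using mult_right_mono[OF K(2)[of y], of "norm y"]
      by (simp add: power2_eq_square mult_ac)
    also have "\<dots> = (sqrt K * norm y)\<^sup>2"
      using K(1) by (simp add: power_mult_distrib)
    finally show ?thesis
      by (rule power2_le_imp_le) (use K(1) in simp)
  qed
  have iter: "norm ((W ^^ k) x) \<le> b ^ k * norm x" for k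
  proof (induction k)
    case (Suc k)
    have "norm ((W ^^ Suc k) x) \<le> b * norm ((W ^^ k) x)"
      using b(2) by simp
    also have "\<dots> \<le> b * (b ^ k * norm x)"
      using Suc b(1) by simp
    finally show ?case
      by (simp add: mult.assoc)
  qed simp
  define M where "M = sqrt K * norm x / a 0"
  have upper: "(r / b) ^ k \<le> M" for k
  proof -
    have "r ^ k * a 0 \<le> sqrt K * (b ^ k * norm x)"
    proof -
      have "r ^ k * a 0 \<le> a k"
        by (rule lower)
      also have "\<dots> \<le> sqrt K * norm ((W ^^ k) x)"
        unfolding a_def by (rule Anorm)
      also have "\<dots> \<le> sqrt K * (b ^ k * norm x)"
        using iter K(1) by (intro mult_left_mono) auto
      finally show ?thesis .
    qed
    then show ?thesis
      using a0 b(1) by (simp add: M_def field_simps)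
  qed
  moreover obtain k where "M < (r / b) ^ k"
    using real_arch_pow[of "r / b" M] r b(1) by auto
  ultimately show False
    by (meson not_le)
qed

text \<open>The composition of \<open>S\<close> followed by \<open>R\<close> is
  \<open>A\<close>-selfadjoint, hence bounded in the seminorm, and the square of
  \<open>A_norm A (S x)\<close> is the inner product of \<open>x\<close> with
  \<open>R (S x)\<close>. This makes the suprema over the sphere finite.\<close>

lemma A_adjoint_pair_bound:
  assumes S: "bounded_clinear S" and R: "bounded_clinear R"
    and adj: "\<And>x y. A_inner A (S x) y = A_inner A x (R y)"
  obtains C where "\<And>x. A_norm A (S x) \<le> C * A_norm A x"
proof -
  have adj': "A_inner A (R x) y = A_inner A x (S y)" for x y
    using adj[of y x] A_inner_commute[of "R x" y] A_inner_commute[of x "S y"] by simp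
  obtain b where b: "0 < b" "\<And>x. norm (R (S x)) \<le> norm x * b"
    using bounded_clinear_compose[OF R S] bounded_linear.pos_bounded
    unfolding bounded_clinear_def by blast
  have W: "A_norm A (R (S x)) \<le> b * A_norm A x" for x
    by (rule A_selfadjoint_bound[where W = "\<lambda>x. R (S x)"])
      (use b in \<open>simp_all add: adj adj' mult.commute\<close>)
  have "A_norm A (S x) \<le> sqrt b * A_norm A x" for x
  proof -
    have "(A_norm A (S x))\<^sup>2 \<le> A_norm A x * A_norm A (R (S x))"
      unfolding A_norm_sq adj by (rule A_cauchy_schwarz_Re)
    also have "\<dots> \<le> A_norm A x * (b * A_norm A x)"
      using W A_norm_nonneg by (rule mult_left_mono)
    also have "\<dots> = (sqrt b * A_norm A x)\<^sup>2"
      using b(1) by (simp add: power_mult_distrib power2_eq_square)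
    finally show ?thesis
      by (rule power2_le_imp_le) (use b(1) A_norm_nonneg in simp)
  qed
  then show thesis
    using that by blast
qed

lemma A_sphere_normalize:
  assumes "A_norm A x \<noteq> 0"
  obtains z where "z \<in> A_sphere A" "x = complex_of_real (A_norm A x) *\<^sub>C z"
proof
  show "complex_of_real (1 / A_norm A x) *\<^sub>C x \<in> A_sphere A"
    using assms A_norm_nonneg[of x] by (simp add: A_sphere_def A_norm_scaleC norm_divide)
  show "x = complex_of_real (A_norm A x) *\<^sub>C complex_of_real (1 / A_norm A x) *\<^sub>C x"
    using assms unfolding scaleC_scaleC of_real_mult[symmetric] scaleC_of_real by simp
qed

section \<open>Operator seminorm and numerical radius for an adjoint pair\<close>

context
  fixes S R
  assumes S: "bounded_clinear S" and R: "bounded_clinear R"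
    and adj: "\<And>x y. A_inner A (S x) y = A_inner A x (R y)"
begin

lemma A_norm_le_opnorm: "A_norm A (S x) \<le> A_opnorm A S * A_norm A x"
proof -
  obtain C where C: "\<And>x. A_norm A (S x) \<le> C * A_norm A x"
    using A_adjoint_pair_bound[OF S R adj] by blast
  show ?thesis
  proof (cases "A_norm A x = 0")
    \<comment> \<open>A vector of seminorm zero cannot be normalized; the crude constant
      \<open>C\<close> shows that its image also has seminorm zero.\<close>
    case True
    then show ?thesis
      using C[of x] by simp
  next
    case False
    then obtain z where z: "z \<in> A_sphere A" "x = complex_of_real (A_norm A x) *\<^sub>C z"
      using A_sphere_normalize by blast
    have "bdd_above ((\<lambda>z. A_norm A (S z)) ` A_sphere A)"
    proof (rule bdd_aboveI2)
      show "A_norm A (S z) \<le> C" if "z \<in> A_sphere A" for z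
        using C[of z] that by (simp add: A_sphere_def)
    qed
    then have "A_norm A (S z) \<le> A_opnorm A S"
      using cSUP_upper[OF z(1)] z(1) by (auto simp: A_opnorm_def)
    moreover have "A_norm A (S x) = A_norm A x * A_norm A (S z)"
      by (subst z(2)) (simp add: bounded_clinear_simps[OF S] A_norm_scaleC A_norm_nonneg)
    ultimately show ?thesis
      using mult_right_mono[of "A_norm A (S z)" "A_opnorm A S" "A_norm A x"] A_norm_nonneg[of x]
      by (simp add: mult.commute)
  qed
qed

lemma A_opnorm_nonneg: "0 \<le> A_opnorm A S"
proof (cases "A_sphere A = {}")
  case False
  then obtain z where "A_norm A z = 1"
    by (auto simp: A_sphere_def)
  then show ?thesis
    using A_norm_le_opnorm[of z] A_norm_nonneg[of "S z"] by simp
qed (simp add: A_opnorm_def)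

lemma A_inner_le_numradius:
  assumes "z \<in> A_sphere A"
  shows "cmod (A_inner A (S z) z) \<le> A_numradius A S"
proof -
  have "bdd_above ((\<lambda>z. cmod (A_inner A (S z) z)) ` A_sphere A)"
  proof (rule bdd_aboveI2)
    show "cmod (A_inner A (S y) y) \<le> A_opnorm A S" if "y \<in> A_sphere A" for y
      using that A_cauchy_schwarz[of "S y" y] A_norm_le_opnorm[of y] by (simp add: A_sphere_def)
  qed
  then show ?thesis
    using cSUP_upper[OF assms] assms by (auto simp: A_numradius_def)
qed

text \<open>The square of \<open>A_norm A (R x)\<close> is the inner product of
  \<open>S (R x)\<close> with \<open>x\<close>; Cauchy--Schwarz produces one factor
  \<open>A_norm A (R x)\<close> that cancels.\<close>

lemma A_adjoint_norm_le: "A_norm A (R x) \<le> A_opnorm A S * A_norm A x"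
proof (cases "A_norm A (R x) = 0")
  case True
  then show ?thesis
    using A_opnorm_nonneg A_norm_nonneg by simp
next
  case False
  have "(A_norm A (R x))\<^sup>2 = Re (A_inner A (S (R x)) x)"
    by (simp add: A_norm_sq adj)
  also have "\<dots> \<le> A_norm A (S (R x)) * A_norm A x"
    by (rule A_cauchy_schwarz_Re)
  also have "\<dots> \<le> (A_opnorm A S * A_norm A (R x)) * A_norm A x"
    using A_norm_le_opnorm A_norm_nonneg by (rule mult_right_mono)
  finally have "A_norm A (R x) * A_norm A (R x) \<le> A_norm A (R x) * (A_opnorm A S * A_norm A x)"
    by (simp add: power2_eq_square mult_ac)
  then show ?thesis
    using False A_norm_nonneg[of "R x"] by simp
qed

end

lemma A_crawford_bounds:
  assumes "z \<in> A_sphere A"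
  shows "0 \<le> A_crawford A S" "A_crawford A S \<le> cmod (A_inner A (S z) z)"
proof -
  show "0 \<le> A_crawford A S"
    using assms by (auto simp: A_crawford_def intro: cINF_greatest)
  have "bdd_below ((\<lambda>z. cmod (A_inner A (S z) z)) ` A_sphere A)"
    by (rule bdd_belowI[of _ 0]) auto
  then show "A_crawford A S \<le> cmod (A_inner A (S z) z)"
    using cINF_lower[OF _ assms] assms by (auto simp: A_crawford_def)
qed

text \<open>Polarization: only differences of the quadratic form enter \<open>Re \<langle>S z, y\<rangle>\<close>.\<close>

lemma A_selfadjoint_opnorm_le:
  assumes S: "bounded_clinear S" and adj: "\<And>x y. A_inner A (S x) y = A_inner A x (S y)"
    and ne: "A_sphere A \<noteq> {}"
    and w: "\<And>z. z \<in> A_sphere A \<Longrightarrow> cmod (A_inner A (S z) z) \<le> w"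
  shows "A_opnorm A S \<le> w"
proof -
  have w0: "0 \<le> w"
    using ne w by (meson all_not_in_conv norm_ge_zero order_trans)
  \<comment> \<open>The bound \<open>w\<close> is extended by homogeneity because polarization
    evaluates the form at \<open>z + y\<close> and \<open>z - y\<close>, which need not lie on the
    sphere.\<close>
  have quad: "\<bar>Re (A_inner A (S x) x)\<bar> \<le> w * (A_norm A x)\<^sup>2" for x
  proof (cases "A_norm A x = 0")
    case True
    then show ?thesis
      using A_cauchy_schwarz[of "S x" x] by simp
  next
    case False
    then obtain z where z: "z \<in> A_sphere A" "x = complex_of_real (A_norm A x) *\<^sub>C z"
      using A_sphere_normalize by blast
    have "A_inner A (S x) x = complex_of_real ((A_norm A x)\<^sup>2) * A_inner A (S z) z"
      by (subst (1 2) z(2)) (simp add: bounded_clinear_simps[OF S] A_inner_simps power2_eq_square)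
    then have "cmod (A_inner A (S x) x) = (A_norm A x)\<^sup>2 * cmod (A_inner A (S z) z)"
      by (simp add: norm_mult norm_power A_norm_nonneg)
    also have "\<dots> \<le> (A_norm A x)\<^sup>2 * w"
      using w[OF z(1)] by (simp add: mult_left_mono)
    finally show ?thesis
      using abs_Re_le_cmod[of "A_inner A (S x) x"] by (simp add: mult.commute)
  qed
  have "A_norm A (S z) \<le> w" if z: "z \<in> A_sphere A" for z
  proof (cases "A_norm A (S z) = 0")
    case False
    \<comment> \<open>Testing against the normalized image makes the inner product of
      \<open>S z\<close> with \<open>y\<close> equal to \<open>A_norm A (S z)\<close>.\<close>
    then obtain y where y: "y \<in> A_sphere A" "S z = complex_of_real (A_norm A (S z)) *\<^sub>C y"
      using A_sphere_normalize by blast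
    have yz: "A_inner A y y = 1" "A_inner A z z = 1"
      using y(1) z by (simp_all add: A_inner_self_eq A_sphere_def)
    have "A_inner A (S z) y = A_norm A (S z)"
      by (subst y(2)) (simp add: A_inner_simps yz)
    moreover have "A_inner A (S y) z = cnj (A_inner A (S z) y)"
      unfolding adj[of y z] by (rule A_inner_commute)
    ultimately have "4 * A_norm A (S z)
        = Re (A_inner A (S (z + y)) (z + y)) - Re (A_inner A (S (z - y)) (z - y))"
      by (simp add: bounded_clinear_simps[OF S] A_inner_simps)
    also have "\<dots> \<le> w * (A_norm A (z + y))\<^sup>2 + w * (A_norm A (z - y))\<^sup>2"
      using quad[of "z + y"] quad[of "z - y"] by linarith
    also have "\<dots> = w * 4"
      unfolding A_norm_sq distrib_left[symmetric] by (simp add: A_inner_simps yz)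
    finally show ?thesis
      by simp
  qed (simp add: w0)
  then show ?thesis
    using ne by (auto simp: A_opnorm_def intro: cSUP_least)
qed

text \<open>Any bounded \<open>R\<close> with \<open>A \<circ> R = cadjoint T \<circ> A\<close>
  becomes the distinguished adjoint after composition with the projection \<open>q\<close> onto the
  orthogonal complement of the kernel of \<open>A\<close>. Boundedness follows although the
  Moore--Penrose inverse itself may be unbounded.\<close>

lemma A_adjoint_properties:
  assumes "T \<in> A_adjointable A"
  shows "bounded_clinear (A_adjoint A T)"
    and "A_inner A (T x) y = A_inner A x (A_adjoint A T y)"
proof -
  obtain R where T: "bounded_clinear T" and R: "bounded_clinear R"
    and AR: "A \<circ> R = cadjoint T \<circ> A"
    using assms by (auto simp: A_adjointable_def)
  have bl: "bounded_linear A"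
    using A_clinear by (simp add: bounded_clinear_def)
  have "subspace {z. A z = 0}"
    by (intro linear_subspace_kernel bounded_linear.linear bl)
  moreover have "closed {z. A z = 0}"
    by (intro closed_Collect_eq continuous_intros linear_continuous_on bl)
  moreover have "c *\<^sub>C v \<in> {z. A z = 0}" if "v \<in> {z. A z = 0}" for c v
    using that
    by (simp add: bounded_clinear_simps[OF A_clinear] linear_simps[OF bounded_linear_scaleC])
  ultimately obtain q where q: "bounded_clinear q"
      "\<And>x. q x \<in> ortho_compl {z. A z = 0}" "\<And>x. A (x - q x) = 0"
    using ortho_compl_projection[of "{z. A z = 0}"] by auto
  have Aq: "A (q x) = A x" for x
    using q(3)[of x] by (simp add: bounded_clinear_simps[OF A_clinear])
  have eq: "A_adjoint A T z = q (R z)" for z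
  proof -
    have "cadjoint T (A z) = A (R z)"
      using fun_cong[OF AR, of z] by simp
    moreover have "mp_inverse A (A (R z)) = q (R z)"
      by (rule mp_inverse_eqI[OF A_clinear q(2)])
        (simp add: Aq ortho_compl_def, metis cinner_diff_left cancel_comm_monoid_add_class.diff_cancel)
    ultimately show ?thesis
      by (simp add: A_adjoint_def)
  qed
  then have "A_adjoint A T = (\<lambda>z. q (R z))"
    by blast
  then show "bounded_clinear (A_adjoint A T)"
    using bounded_clinear_compose[OF q(1) R] by simp
  have "A_inner A (T x) y = cinner (T x) (A y)"
    by (simp add: A_inner_def cinner_A_commute)
  also have "\<dots> = cinner x (cadjoint T (A y))"
    by (rule cinner_cadjoint[OF T])
  also have "\<dots> = cinner x (A (A_adjoint A T y))"
    using fun_cong[OF AR, of y] by (simp add: eq Aq)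
  finally show "A_inner A (T x) y = A_inner A x (A_adjoint A T y)"
    by (simp add: A_inner_def cinner_A_commute)
qed

text \<open>The operator \<open>T\<close> itself is the required witness. Hence the second adjoint
  in \<open>P_op\<close> and \<open>Q_op\<close> has the expected properties.\<close>

lemma A_adjoint_adjointable:
  assumes T: "T \<in> A_adjointable A"
  shows "A_adjoint A T \<in> A_adjointable A"
proof -
  have "A (T z) = cadjoint (A_adjoint A T) (A z)" for z
  proof -
    have "cinner x (cadjoint (A_adjoint A T) (A z)) = cinner x (A (T z))" for x
    proof -
      have "cinner x (cadjoint (A_adjoint A T) (A z)) = cinner (A_adjoint A T x) (A z)"
        by (rule cinner_cadjoint[OF A_adjoint_properties(1)[OF T], symmetric])
      also have "\<dots> = A_inner A (A_adjoint A T x) z"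
        by (simp add: A_inner_def cinner_A_commute)
      also have "\<dots> = cnj (A_inner A (T z) x)"
        unfolding A_adjoint_properties(2)[OF T] by (rule A_inner_commute)
      also have "\<dots> = A_inner A x (T z)"
        by (rule A_inner_commute[symmetric])
      also have "\<dots> = cinner x (A (T z))"
        by (simp add: A_inner_def cinner_A_commute)
      finally show ?thesis .
    qed
    then have "cinner (cadjoint (A_adjoint A T) (A z) - A (T z))
        (cadjoint (A_adjoint A T) (A z) - A (T z)) = 0"
      by (simp add: cinner_diff_right)
    then show ?thesis
      by (auto dest: cinner_self_eq_0)
  qed
  then show ?thesis
    using T A_adjoint_properties(1)[OF T] by (auto simp: A_adjointable_def fun_eq_iff)
qed


section \<open>The numerical radius of commutators\<close>

context
  fixes T
  assumes T: "T \<in> A_adjointable A"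
begin

lemmas adjoint_properties = A_adjoint_properties[OF T]
lemmas biadjoint_properties = A_adjoint_properties[OF A_adjoint_adjointable[OF T]]

lemma adjointable_clinear: "bounded_clinear T"
  using T by (simp add: A_adjointable_def)

lemma A_inner_adjoint_left: "A_inner A (A_adjoint A T x) y = A_inner A x (T y)"
  using adjoint_properties(2)[of y x] A_inner_commute[of "A_adjoint A T x" y] A_inner_commute[of x "T y"]
  by simp

lemma A_inner_biadjoint_right:
  "A_inner A x (A_adjoint A (A_adjoint A T) y) = A_inner A x (T y)"
  using biadjoint_properties(2)[of x y] by (simp add: A_inner_adjoint_left)

lemma A_inner_biadjoint_left:
  "A_inner A (A_adjoint A (A_adjoint A T) x) y = A_inner A (T x) y"
  using A_inner_biadjoint_right[of y x] A_inner_commute[of _ y] by simp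

lemmas adjoint_simps = A_inner_biadjoint_left A_inner_biadjoint_right A_inner_adjoint_left
  adjoint_properties(2)[symmetric]

lemma P_plus_Q_clinear: "bounded_clinear (\<lambda>z. P_op A T z + Q_op A T z)"
  and P_minus_Q_clinear: "bounded_clinear (\<lambda>z. P_op A T z - Q_op A T z)"
  unfolding P_op_def Q_op_def
  by (intro bounded_clinear_add bounded_clinear_diff bounded_clinear_scaleC adjoint_properties(1) biadjoint_properties(1))+

lemma P_op_selfadjoint: "A_inner A (P_op A T x) y = A_inner A x (P_op A T y)"
  by (simp add: P_op_def A_inner_simps adjoint_simps)

lemma Q_op_selfadjoint: "A_inner A (Q_op A T x) y = A_inner A x (Q_op A T y)"
  by (simp add: Q_op_def A_inner_simps adjoint_simps field_simps)

lemma A_inner_P_op: "A_inner A (P_op A T z) z = Re (A_inner A (T z) z)"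
  using A_inner_commute[of z "T z"]
  by (simp add: P_op_def A_inner_simps adjoint_simps complex_eq_iff)

text \<open>The minus sign arises because the adjoint comes first in the difference: a number
  subtracted from its conjugate leaves \<open>- 2 * \<i>\<close> times its imaginary part.\<close>

lemma A_inner_Q_op: "A_inner A (Q_op A T z) z = - Im (A_inner A (T z) z)"
  using A_inner_commute[of z "T z"]
  by (simp add: Q_op_def A_inner_simps adjoint_simps complex_eq_iff)

lemma P_Q_quadratic_sum:
  "(cmod (A_inner A (P_op A T z - Q_op A T z) z))\<^sup>2 + (cmod (A_inner A (P_op A T z + Q_op A T z) z))\<^sup>2
    = 2 * (cmod (A_inner A (T z) z))\<^sup>2"
  unfolding A_inner_simps A_inner_P_op A_inner_Q_op cmod_power2
  by (simp add: power2_eq_square algebra_simps)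

text \<open>The parallelogram law is used twice: for \<open>P_op A T x\<close> and
  \<open>Q_op A T x\<close>, then for the two adjoints whose half sum and difference these
  are.\<close>

lemma P_Q_norm_sum:
  "(A_norm A (P_op A T x - Q_op A T x))\<^sup>2 + (A_norm A (P_op A T x + Q_op A T x))\<^sup>2
    = (A_norm A (A_adjoint A T x))\<^sup>2 + (A_norm A (T x))\<^sup>2"
proof -
  let ?a = "A_adjoint A T x" and ?b = "A_adjoint A (A_adjoint A T) x"
  have "A_norm A (?a + ?b) = 2 * A_norm A (P_op A T x)"
    "A_norm A (?a - ?b) = 2 * A_norm A (Q_op A T x)"
    by (simp_all add: P_op_def Q_op_def A_norm_scaleC norm_divide norm_mult)
  moreover have "A_norm A ?b = A_norm A (T x)"
    by (simp add: A_norm_def A_inner_biadjoint_left A_inner_biadjoint_right)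
  ultimately show ?thesis
    using A_norm_parallelogram[of ?a ?b] A_norm_parallelogram[of "P_op A T x" "Q_op A T x"]
    by (simp add: power_mult_distrib)
qed

lemma alpha_lower_bound:
  assumes ne: "A_sphere A \<noteq> {}"
  shows "0 \<le> alpha A T"
    and "(A_opnorm A (\<lambda>z. P_op A T z - Q_op A T z))\<^sup>2
        + (A_opnorm A (\<lambda>z. P_op A T z + Q_op A T z))\<^sup>2 \<le> 4 * (alpha A T)\<^sup>2"
proof -
  define D S where "D = (\<lambda>z. P_op A T z - Q_op A T z)" and "S = (\<lambda>z. P_op A T z + Q_op A T z)"
  have SD: "bounded_clinear D" "bounded_clinear S"
      "\<And>x y. A_inner A (D x) y = A_inner A x (D y)" "\<And>x y. A_inner A (S x) y = A_inner A x (S y)"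
    by (simp_all add: D_def S_def P_plus_Q_clinear P_minus_Q_clinear A_inner_simps
        P_op_selfadjoint Q_op_selfadjoint)
  have sum: "(cmod (A_inner A (D z) z))\<^sup>2 + (cmod (A_inner A (S z) z))\<^sup>2
      \<le> 2 * (A_numradius A T)\<^sup>2" if "z \<in> A_sphere A" for z
    using P_Q_quadratic_sum[of z]
      power_mono[OF A_inner_le_numradius[OF adjointable_clinear adjoint_properties that], of 2]
    by (simp add: D_def S_def)
  have main: "(A_opnorm A U)\<^sup>2 + (A_crawford A V)\<^sup>2 \<le> 2 * (A_numradius A T)\<^sup>2"
    if U: "bounded_clinear U" "\<And>x y. A_inner A (U x) y = A_inner A x (U y)"
      and UV: "\<And>z. z \<in> A_sphere A \<Longrightarrow>
        (cmod (A_inner A (U z) z))\<^sup>2 + (cmod (A_inner A (V z) z))\<^sup>2 \<le> 2 * (A_numradius A T)\<^sup>2"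
    for U V
  proof -
    \<comment> \<open>What remains of the joint bound for the form of \<open>U\<close> once
      \<open>V\<close> has taken its least possible share.\<close>
    define m where "m = 2 * (A_numradius A T)\<^sup>2 - (A_crawford A V)\<^sup>2"
    have le: "(cmod (A_inner A (U z) z))\<^sup>2 \<le> m" if "z \<in> A_sphere A" for z
      using UV[OF that] power_mono[OF A_crawford_bounds(2,1)[OF that, of V], of 2]
      by (simp add: m_def)
    then have m: "0 \<le> m"
      using ne by (meson all_not_in_conv order_trans zero_le_power2)
    have "A_opnorm A U \<le> sqrt m"
      by (rule A_selfadjoint_opnorm_le[OF U ne]) (simp add: le real_le_rsqrt)
    then have "(A_opnorm A U)\<^sup>2 \<le> (sqrt m)\<^sup>2"
      by (rule power_mono) (rule A_opnorm_nonneg[OF U(1) U(1) U(2)])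
    then show ?thesis
      using m by (simp add: m_def)
  qed
  define X where "X = (A_numradius A T)\<^sup>2 - 1 / 4 *
          ((A_crawford A D)\<^sup>2 + (A_crawford A S)\<^sup>2
           + \<bar>(A_opnorm A S)\<^sup>2 - (A_opnorm A D)\<^sup>2 + (A_crawford A D)\<^sup>2 - (A_crawford A S)\<^sup>2\<bar>)"
  have "(A_opnorm A D)\<^sup>2 + (A_crawford A S)\<^sup>2 \<le> 2 * (A_numradius A T)\<^sup>2"
    using main[OF SD(1,3)] sum by blast
  moreover have "(A_opnorm A S)\<^sup>2 + (A_crawford A D)\<^sup>2 \<le> 2 * (A_numradius A T)\<^sup>2"
    using main[OF SD(2,4)] sum by (simp add: add.commute)
  \<comment> \<open>The absolute value in \<open>X\<close> is that of the difference of the two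
    left-hand sides, so either sign reduces the claim to one of the two inequalities.\<close>
  ultimately have X: "(A_opnorm A D)\<^sup>2 + (A_opnorm A S)\<^sup>2 \<le> 4 * X"
    unfolding X_def by (simp add: abs_if field_simps)
  \<comment> \<open>The radicand must be nonnegative for the square of \<open>alpha A T\<close> to
    be \<open>X\<close>, since \<open>sqrt\<close> is odd on the reals.\<close>
  then have X0: "0 \<le> X"
    by (smt (verit) zero_le_power2)
  have al: "alpha A T = sqrt X"
    by (simp add: alpha_def X_def Let_def D_def S_def)
  show "0 \<le> alpha A T"
    using al X0 by simp
  show "(A_opnorm A (\<lambda>z. P_op A T z - Q_op A T z))\<^sup>2
        + (A_opnorm A (\<lambda>z. P_op A T z + Q_op A T z))\<^sup>2 \<le> 4 * (alpha A T)\<^sup>2"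
    using al X X0 by (simp add: D_def S_def)
qed

text \<open>The sum of squares is at most \<open>4 * (alpha A T)\<^sup>2\<close>; passing to the
  squared sum costs a further factor \<open>2\<close>, whence \<open>2 * sqrt 2\<close>.\<close>

lemma A_norm_adjoint_sum:
  assumes x: "x \<in> A_sphere A"
  shows "A_norm A (A_adjoint A T x) + A_norm A (T x) \<le> 2 * sqrt 2 * alpha A T"
proof -
  have ne: "A_sphere A \<noteq> {}"
    using x by blast
  let ?D = "\<lambda>z. P_op A T z - Q_op A T z" and ?S = "\<lambda>z. P_op A T z + Q_op A T z"
  have le: "(A_norm A (U x))\<^sup>2 \<le> (A_opnorm A U)\<^sup>2"
    if "bounded_clinear U" "\<And>x y. A_inner A (U x) y = A_inner A x (U y)" for U
    using A_norm_le_opnorm[OF that(1,1,2), of x] x A_norm_nonneg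
    by (simp add: A_sphere_def power_mono)
  have D: "(A_norm A (?D x))\<^sup>2 \<le> (A_opnorm A ?D)\<^sup>2"
    by (rule le[OF P_minus_Q_clinear])
      (simp add: A_inner_simps P_op_selfadjoint Q_op_selfadjoint)
  have S: "(A_norm A (?S x))\<^sup>2 \<le> (A_opnorm A ?S)\<^sup>2"
    by (rule le[OF P_plus_Q_clinear])
      (simp add: A_inner_simps P_op_selfadjoint Q_op_selfadjoint)
  have "(A_norm A (A_adjoint A T x) + A_norm A (T x))\<^sup>2
      \<le> 2 * ((A_norm A (A_adjoint A T x))\<^sup>2 + (A_norm A (T x))\<^sup>2)"
    using zero_le_power2[of "A_norm A (A_adjoint A T x) - A_norm A (T x)"]
    by (simp add: power2_sum power2_diff)
  also have "\<dots> \<le> 2 * (4 * (alpha A T)\<^sup>2)"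
    using order_trans[OF add_mono[OF D S] alpha_lower_bound(2)[OF ne]]
    unfolding P_Q_norm_sum by (rule mult_left_mono) simp
  also have "\<dots> = (2 * sqrt 2 * alpha A T)\<^sup>2"
    by (simp add: power_mult_distrib)
  finally show ?thesis
    by (rule power2_le_imp_le) (use alpha_lower_bound(1)[OF ne] in simp)
qed

end

text \<open>In both products the outer operator is moved to the other side. Then \<open>T2\<close>
  or its adjoint is absorbed into \<open>A_opnorm A T2\<close>, while \<open>T1\<close> and its
  adjoint stay applied to the same vector \<open>x\<close>, where their seminorms are bounded
  jointly.\<close>

lemma A_inner_products_le:
  assumes T1: "T1 \<in> A_adjointable A" and T2: "T2 \<in> A_adjointable A" and x: "x \<in> A_sphere A"
  shows "cmod (A_inner A (T1 (T2 x)) x) + cmod (A_inner A (T2 (T1 x)) x)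
    \<le> 2 * sqrt 2 * h_bound A T1 T2"
proof -
  have x1: "A_norm A x = 1"
    using x by (simp add: A_sphere_def)
  note adj2 = adjointable_clinear[OF T2] A_adjoint_properties[OF T2]
  have "cmod (A_inner A (T1 (T2 x)) x) \<le> A_norm A (T2 x) * A_norm A (A_adjoint A T1 x)"
    unfolding A_adjoint_properties(2)[OF T1] by (rule A_cauchy_schwarz)
  also have "\<dots> \<le> A_opnorm A T2 * A_norm A (A_adjoint A T1 x)"
    using A_norm_le_opnorm[OF adj2, of x] x1 A_norm_nonneg by (simp add: mult_right_mono)
  finally have 1: "cmod (A_inner A (T1 (T2 x)) x) \<le> A_opnorm A T2 * A_norm A (A_adjoint A T1 x)" .
  have "cmod (A_inner A (T2 (T1 x)) x) \<le> A_norm A (T1 x) * A_norm A (A_adjoint A T2 x)"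
    unfolding A_adjoint_properties(2)[OF T2] by (rule A_cauchy_schwarz)
  also have "\<dots> \<le> A_norm A (T1 x) * A_opnorm A T2"
    using A_adjoint_norm_le[OF adj2, of x] x1 A_norm_nonneg by (simp add: mult_left_mono)
  finally have "cmod (A_inner A (T1 (T2 x)) x) + cmod (A_inner A (T2 (T1 x)) x)
      \<le> A_opnorm A T2 * (A_norm A (A_adjoint A T1 x) + A_norm A (T1 x))"
    using 1 by (simp add: algebra_simps)
  also have "\<dots> \<le> A_opnorm A T2 * (2 * sqrt 2 * alpha A T1)"
    using A_norm_adjoint_sum[OF T1 x] A_opnorm_nonneg[OF adj2] by (rule mult_left_mono)
  finally show ?thesis
    by (simp add: h_bound_def mult_ac)
qed

end

theorem corollary32:
  fixes A T1 T2 :: "'a::complex_hilbert_space \<Rightarrow> 'a"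
  assumes "positive_op A"
    and "T1 \<in> A_adjointable A"
    and "T2 \<in> A_adjointable A"
  shows "A_numradius A (\<lambda>z. T1 (T2 z) + T2 (T1 z))
           \<le> 2 * sqrt 2 * min (h_bound A T1 T2) (h_bound A T2 T1)
       \<and> A_numradius A (\<lambda>z. T1 (T2 z) - T2 (T1 z))
           \<le> 2 * sqrt 2 * min (h_bound A T1 T2) (h_bound A T2 T1)"
proof (cases "A_sphere A = {}")
  \<comment> \<open>On an empty sphere the numerical radii and the operator seminorms are
    \<open>0\<close> by convention, so both sides vanish.\<close>
  case True
  then show ?thesis
    by (simp add: A_numradius_def h_bound_def A_opnorm_def)
next
  case False
  let ?B = "2 * sqrt 2 * min (h_bound A T1 T2) (h_bound A T2 T1)"
  \<comment> \<open>The sum of moduli is symmetric in \<open>T1\<close> and \<open>T2\<close>, which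
    yields the minimum, and it controls both signs through the triangle inequality.\<close>
  have le: "cmod (A_inner A (T1 (T2 x)) x) + cmod (A_inner A (T2 (T1 x)) x) \<le> ?B"
    if "x \<in> A_sphere A" for x
    using A_inner_products_le[OF assms that] A_inner_products_le[OF assms(1,3,2) that]
    by (simp add: min_def)
  have "cmod (A_inner A (T1 (T2 x) + T2 (T1 x)) x) \<le> ?B" if "x \<in> A_sphere A" for x
    using le[OF that] norm_triangle_ineq[of "A_inner A (T1 (T2 x)) x" "A_inner A (T2 (T1 x)) x"]
    by (simp add: A_inner_add_left[OF assms(1)])
  moreover have "cmod (A_inner A (T1 (T2 x) - T2 (T1 x)) x) \<le> ?B" if "x \<in> A_sphere A" for x
    using le[OF that] norm_triangle_ineq4[of "A_inner A (T1 (T2 x)) x" "A_inner A (T2 (T1 x)) x"]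
    by (simp add: A_inner_diff_left[OF assms(1)])
  ultimately show ?thesis
    using False by (auto simp: A_numradius_def intro!: cSUP_least)
qed

end
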